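(* Let $3\le r\le 8$. Each $(r-1)$-simplex in the Gosset polytope $(r-4)_{21}$ corresponds to an exceptional system in the del Pezzo surface $S_r$: if $l_1,\dots,l_r\in L_r$ are the vertices of the simplex, there is $D\in\mathcal{E}_r$ with $K_{S_r}+3D=l_1+\dots+l_r$. Moreover, for $3\le r\le 7$, the Weyl group $W(S_r)$ acts transitively on the set $\mathcal{E}_r$ of exceptional systems, and $\mathcal{E}_r$ is bijective to the set $L_r^r$ of skew $r$-lines in $Pic\,S_r$.
   Context: $S_r$ is a del Pezzo surface obtained by blowing up $\mathbb{P}^2$ at $r$ points in general position. $Pic\,S_r=\mathbb{Z}h\oplus\mathbb{Z}e_1\oplus\dots\oplus\mathbb{Z}e_r$ with $h^2=1$, $h\cdot e_i=0$, $e_i\cdot e_j=-\delta_{ij}$, and $K_{S_r}=-3h+\sum_{i=1}^r e_i$. Lines: $L_r=\{l\in Pic\,S_r\mid l^2=l\cdot K_{S_r}=-1\}$; distinct lines are disjoint (skew) if their intersection is $0$. Skew $r$-lines: $L_r^r=\{l_1+\dots+l_r\mid l_i\in L_r\text{ pairwise disjoint distinct lines}\}$. Exceptional systems: $\mathcal{E}_r=\{D\in Pic\,S_r\mid D^2=1,\ K_{S_r}\cdot D=-3\}$. Roots: $R_r=\{d\in Pic\,S_r\mid d^2=-2,\ d\cdot K_{S_r}=0\}$; for $d\in R_r$, $\sigma_d(D)=D+(D\cdot d)d$. The Weyl group $W(S_r)$ (of type $E_r$) is generated by the $\sigma_d$ for the simple roots $d_0=h-e_1-e_2-e_3$, $d_i=e_i-e_{i+1}$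 ($1\le i\le r-1$), and acts on $Pic\,S_r$ preserving the intersection form and $K_{S_r}$. The Gosset polytope $(r-4)_{21}$ is the $r$-dimensional semiregular polytope with symmetry group the Coxeter group $E_r$ ($E_3=A_1\times A_2$, $E_4=A_4$, $E_5=D_5$), realized as the convex hull of $L_r$ in $\{D\in Pic\,S_r\otimes\mathbb{Q}\mid -D\cdot K_{S_r}=1\}$ with the Euclidean metric given by minus the intersection form; its vertices are exactly the elements of $L_r$. An $(r-1)$-simplex in it is a facet that is a regular simplex. *)

theory Defs
  imports "HOL-Analysis.Analysis" "HOL-Algebra.Group_Action"
    "HOL-Algebra.Generated_Groups"
begin

text \<open>
  The Picard lattice of the blow-up of the projective plane at points indexed by the finite
  type \<open>'n\<close>, so that \<open>r = CARD('n)\<close>. The component \<open>None\<close> is the coefficient of \<open>h\<close>, and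
  the component \<open>Some i\<close> is the coefficient of the exceptional class \<open>e\<^sub>i\<close>. The same layout with
  real coefficients is used for the real extension of the lattice.
\<close>

type_synonym 'n pic = "(int, 'n option) vec"
type_synonym 'n rpic = "(real, 'n option) vec"

definition hyp :: "'n::finite pic" where
  "hyp = axis None 1"

definition exc :: "'n \<Rightarrow> 'n::finite pic" where
  "exc i = axis (Some i) 1"

definition isect :: "('a::comm_ring_1, 'n::finite option) vec \<Rightarrow> ('a, 'n option) vec \<Rightarrow> 'a" where
  "isect D D' = D $ None * D' $ None - (\<Sum>i\<in>UNIV. D $ Some i * D' $ Some i)"

definition canonical :: "'n::finite pic" where
  "canonical = (-3) *s hyp + (\<Sum>i\<in>UNIV. exc i)"

definition pic_lines :: "'n::finite pic set" where
  "pic_lines = {l. isect l l = -1 \<and> isect l canonical = -1}"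

definition exceptional_systems :: "'n::finite pic set" where
  "exceptional_systems = {D. isect D D = 1 \<and> isect canonical D = -3}"

text \<open>A skew \<open>r\<close>-line is the divisor class of the sum, not the set of summands.\<close>

definition skew_lines :: "'n::finite pic set" where
  "skew_lines = {(\<Sum>l\<in>A. l) | A.
     A \<subseteq> pic_lines \<and> card A = CARD('n) \<and> pairwise (\<lambda>l l'. isect l l' = 0) A}"

definition reflection :: "'n::finite pic \<Rightarrow> 'n pic \<Rightarrow> 'n pic" where
  "reflection d D = D + isect D d *s d"

text \<open>
  The simple roots depend on an enumeration \<open>p 1, \<dots>, p r\<close> of the blown-up points.
\<close>

definition simple_roots :: "(nat \<Rightarrow> 'n) \<Rightarrow> 'n::finite pic set" where
  "simple_roots p = insert (hyp - exc (p 1) - exc (p 2) - exc (p 3))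
     {exc (p i) - exc (p (i + 1)) | i. 1 \<le> i \<and> i < CARD('n)}"

definition weyl_group :: "(nat \<Rightarrow> 'n) \<Rightarrow> ('n::finite pic \<Rightarrow> 'n pic) monoid" where
  "weyl_group p = (BijGroup UNIV)
     \<lparr>carrier := generate (BijGroup UNIV) (reflection ` simple_roots p)\<rparr>"

definition real_pic :: "'n::finite pic \<Rightarrow> 'n rpic" where
  "real_pic D = (\<chi> j. of_int (D $ j))"

definition gosset_polytope :: "'n::finite rpic set" where
  "gosset_polytope = convex hull (real_pic ` pic_lines)"

text \<open>
  Minus the intersection form is positive definite only on the orthogonal complement of the
  canonical class, so this is a metric on the affine hyperplane containing the polytope, but not
  on the whole space. It differs from the library's \<open>dist\<close>.
\<close>

definition pic_dist :: "'n::finite rpic \<Rightarrow> 'n rpic \<Rightarrow> real" where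
  "pic_dist x y = sqrt (- isect (x - y) (x - y))"

text \<open>The facets of the polytope that are regular simplices; \<open>C\<close> is the vertex set of \<open>F\<close>.\<close>

definition gosset_simplices :: "'n::finite rpic set set" where
  "gosset_simplices = {F. F facet_of gosset_polytope \<and>
     (\<exists>C s. \<not> affine_dependent C \<and> card C = CARD('n) \<and> F = convex hull C \<and>
            (\<forall>x\<in>C. \<forall>y\<in>C. x \<noteq> y \<longrightarrow> pic_dist x y = s))}"

end

theory Submission imports Defs begin

text \<open>
  Everything rests on two facts: the intersection form is negative definite on the orthogonal
  complement of \<open>K\<close> as long as at most eight points are blown up
  (\<open>negative_definite_orthogonal_canonical\<close>), and a class that pairs non-negatively with all
  simple roots can be identified by Noether's classical inequality for plane curves
  (\<open>noether_inequality\<close>). Reflecting in a simple root that pairs negatively with a class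
  lowers an integer valued \<open>height\<close>, so statements that are invariant under simple reflections
  need to be checked for dominant classes only.

  For exceptional systems and at most seven points, negative definiteness makes the height
  non-negative, and \<open>h\<close> is the only dominant exceptional system. The resulting induction
  principle \<open>exceptional_system_induct\<close> says that every exceptional system is obtained from \<open>h\<close>
  by simple reflections. This is transitivity of the Weyl group; and since
  \<open>K + 3h = e\<^sub>1 + \<dots> + e\<^sub>r\<close> is a sum of skew lines and reflections permute the lines and fix
  \<open>K\<close>, it also shows that \<open>K + 3D\<close> is a skew \<open>r\<close>-line for every exceptional system \<open>D\<close>.

  Conversely, \<open>r\<close> skew lines \<open>l\<^sub>1, \<dots>, l\<^sub>r\<close> can be contracted to a projective plane, and \<open>D\<close> is the
  pullback of the class of a line. In the lattice: \<open>v = l\<^sub>1 + \<dots> + l\<^sub>r - K\<close> is orthogonal to all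
  \<open>l\<^sub>i\<close>, has square \<open>9\<close>, and is divisible by \<open>3\<close> because the lattice is unimodular
  (\<open>skew_lines_sum\<close>).

  For the simplices it remains to see that the vertices of a simplex facet are pairwise skew. Its
  edges are edges of the polytope. Two distinct lines \<open>l\<close>, \<open>m\<close> are separated by a root
  (\<open>separating_root\<close>), since otherwise a Weyl group element would make both dominant, and there
  is only one dominant line. Reflecting \<open>l\<close> and \<open>m\<close> in that root gives two lines whose segment
  crosses the segment from \<open>l\<close> to \<open>m\<close> at an interior point. If the latter is an edge, this forces
  \<open>m\<close> to be the reflection of \<open>l\<close>, so that \<open>l \<cdot> m\<close> is \<open>0\<close> or at least \<open>3\<close> (\<open>edge_isect\<close>).
  In the second case \<open>l\<close> determines \<open>m\<close> (\<open>lines_far_apart\<close>), which is impossible in a regular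
  simplex with three or more vertices.
\<close>

section \<open>The intersection form\<close>

lemma isect_commute: "isect x y = isect y x"
  by (simp add: isect_def mult.commute)

lemma isect_add_left: "isect (x + y) z = isect x z + isect y z"
  by (simp add: isect_def algebra_simps sum.distrib)

lemma isect_diff_left: "isect (x - y) z = isect x z - isect y z"
  by (simp add: isect_def algebra_simps sum_subtractf)

lemma isect_scale_left: "isect (c *s x) z = c * isect x z"
  by (simp add: isect_def algebra_simps sum_distrib_left)

lemma isect_zero_left: "isect 0 z = 0"
  by (simp add: isect_def)

lemma isect_zero_right: "isect z 0 = 0"
  by (simp add: isect_def)

lemma isect_sum_left: "isect (\<Sum>a\<in>A. f a) z = (\<Sum>a\<in>A. isect (f a) z)"
  by (induction A rule: infinite_finite_induct) (simp_all add: isect_zero_left isect_add_left)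

lemma isect_add_right: "isect z (x + y) = isect z x + isect z y"
  by (metis isect_add_left isect_commute)

lemma isect_diff_right: "isect z (x - y) = isect z x - isect z y"
  by (metis isect_diff_left isect_commute)

lemma isect_scale_right: "isect z (c *s x) = c * isect z x"
  by (metis isect_scale_left isect_commute)

lemma isect_sum_right: "isect z (\<Sum>a\<in>A. f a) = (\<Sum>a\<in>A. isect z (f a))"
  by (simp add: isect_commute[of z] isect_sum_left)

lemmas isect_bilinear =
  isect_add_left isect_diff_left isect_scale_left isect_sum_left isect_zero_left
  isect_add_right isect_diff_right isect_scale_right isect_sum_right

lemma isect_hyp: "isect D hyp = D $ None"
  by (simp add: isect_def hyp_def axis_def)

lemma isect_exc: "isect D (exc i) = - D $ Some i"
  by (simp add: isect_def exc_def axis_def if_distrib sum.delta cong: if_cong)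

lemma isect_canonical: "isect D canonical = - 3 * D $ None - (\<Sum>i\<in>UNIV. D $ Some i)"
  by (simp add: canonical_def isect_bilinear isect_hyp isect_exc sum_negf)

lemma isect_self: "isect D D = (D $ None)\<^sup>2 - (\<Sum>i\<in>UNIV. (D $ Some i)\<^sup>2)"
  by (simp add: isect_def power2_eq_square)

lemma exc_nth: "exc i $ None = 0" "exc i $ Some j = (if i = j then 1 else 0)"
  by (auto simp: exc_def axis_def)

lemma hyp_nth: "hyp $ None = 1" "hyp $ Some j = 0"
  by (auto simp: hyp_def axis_def)

lemma isect_basis:
  "isect hyp hyp = 1" "isect hyp (exc i) = 0" "isect (exc i) hyp = 0"
  "isect (exc i) (exc j) = (if i = j then -1 else 0)"
  by (simp_all add: isect_hyp isect_exc exc_nth hyp_nth)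

lemma isect_basis_canonical: "isect hyp canonical = -3" "isect (exc i) canonical = -1"
  by (simp_all add: isect_canonical exc_nth hyp_nth)

lemma isect_canonical_self: "isect canonical (canonical :: 'n::finite pic) = 9 - int CARD('n)"
proof -
  have "(canonical :: 'n pic) $ None = -3" "\<And>i. (canonical :: 'n pic) $ Some i = 1"
    using isect_hyp[of "canonical :: 'n pic"] isect_exc[of "canonical :: 'n pic"]
    by (simp_all add: isect_commute[of canonical hyp] isect_commute[of canonical "exc _"]
        isect_basis_canonical)
  then show ?thesis
    by (simp add: isect_self)
qed

lemma exceptional_systems_iff:
  "D \<in> exceptional_systems \<longleftrightarrow> isect D D = 1 \<and> isect D canonical = -3"
  by (simp add: exceptional_systems_def isect_commute[of canonical D])

section \<open>Negative definiteness\<close>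

text \<open>
  Write \<open>x = d h + \<Sum> x\<^sub>i e\<^sub>i\<close>. Orthogonality to \<open>K\<close> says \<open>\<Sum> x\<^sub>i = -3d\<close>, so by Cauchy-Schwarz
  \<open>9 d\<^sup>2 \<le> 8 \<Sum> x\<^sub>i\<^sup>2\<close>, that is, \<open>9 x\<^sup>2 \<le> - \<Sum> x\<^sub>i\<^sup>2\<close>. The bound fails for nine points, where \<open>K\<close>
  itself is isotropic and orthogonal to \<open>K\<close>.
\<close>

lemma negative_definite_orthogonal_canonical:
  fixes x :: "'n::finite pic"
  assumes r: "CARD('n) \<le> 8" and K: "isect x canonical = 0"
  shows "isect x x \<le> 0" and "isect x x = 0 \<Longrightarrow> x = 0"
proof -
  define d where "d = x $ None"
  define q where "q = (\<Sum>i\<in>UNIV. (x $ Some i)\<^sup>2)"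
  have S: "(\<Sum>i\<in>UNIV. x $ Some i) = - 3 * d"
    using K by (simp add: isect_canonical d_def)
  \<comment> \<open>Cauchy-Schwarz: the vectors \<open>(x\<^sub>i)\<close> and \<open>(1, \<dots>, 1)\<close> are proportional in the extreme
    case \<open>x\<^sub>i = -3d/8\<close>.\<close>
  have "0 \<le> (\<Sum>i\<in>UNIV. (8 * x $ Some i + 3 * d)\<^sup>2)"
    by (intro sum_nonneg) simp
  also have "\<dots> = 64 * q + 48 * d * (\<Sum>i\<in>UNIV. x $ Some i) + 9 * int CARD('n) * d\<^sup>2"
    by (simp add: q_def power2_eq_square algebra_simps sum.distrib sum_distrib_left sum_distrib_right)
  also have "\<dots> \<le> 64 * q - 144 * d\<^sup>2 + 72 * d\<^sup>2"
    using mult_right_mono[of "9 * int CARD('n)" 72 "d\<^sup>2"] r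
    by (simp add: S power2_eq_square)
  finally have "9 * d\<^sup>2 \<le> 8 * q" by simp
  then have *: "9 * isect x x \<le> - q"
    by (simp add: isect_self d_def q_def)
  have q0: "0 \<le> q" by (simp add: q_def sum_nonneg)
  show "isect x x \<le> 0" using * q0 by simp
  assume "isect x x = 0"
  then have "q = 0" using * q0 by simp
  then have some: "x $ Some i = 0" for i
    by (simp add: q_def sum_nonneg_eq_0_iff)
  with S have "d = 0" by simp
  then have "x $ j = 0" for j
    using some by (cases j) (simp_all add: d_def)
  then show "x = 0" by (simp add: vec_eq_iff)
qed

text \<open>
  The difference of two lines is orthogonal to \<open>K\<close> and has square \<open>-2 - 2 (l \<cdot> m)\<close>.
\<close>

lemma distinct_lines_isect_nonneg:
  fixes l m :: "'n::finite pic"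
  assumes r: "CARD('n) \<le> 8" and l: "l \<in> pic_lines" and m: "m \<in> pic_lines" and "l \<noteq> m"
  shows "0 \<le> isect l m"
proof (rule ccontr)
  assume neg: "\<not> 0 \<le> isect l m"
  have K: "isect (l - m) canonical = 0"
    using l m by (simp add: pic_lines_def isect_bilinear)
  have "isect (l - m) (l - m) = - 2 - 2 * isect l m"
    using l m by (simp add: pic_lines_def isect_bilinear isect_commute[of m l])
  with neg negative_definite_orthogonal_canonical[OF r K] have "l - m = 0" by fastforce
  with \<open>l \<noteq> m\<close> show False by simp
qed

text \<open>
  With \<open>N = K\<^sup>2\<close>, the class \<open>N (D - 2l) + K\<close> is orthogonal to \<open>K\<close>, and if \<open>D \<cdot> l\<close> were negative
  its square would be at least \<open>N (N - 1)\<close>. This is positive for \<open>N \<ge> 2\<close>, that is, for at most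
  seven points. For eight points \<open>3h - e\<^sub>1 - \<dots> - e\<^sub>7 + e\<^sub>8\<close> is an exceptional system meeting
  \<open>e\<^sub>8\<close> negatively.
\<close>

lemma exceptional_isect_line_nonneg:
  fixes D l :: "'n::finite pic"
  assumes r: "CARD('n) \<le> 7" and D: "D \<in> exceptional_systems" and l: "l \<in> pic_lines"
  shows "0 \<le> isect D l"
proof (rule ccontr)
  assume "\<not> 0 \<le> isect D l"
  define N where "N = isect canonical (canonical :: 'n pic)"
  have N: "2 \<le> N" using r by (simp add: N_def isect_canonical_self)
  define z where "z = N *s (D - 2 *s l) + canonical"
  have [simp]: "isect D D = 1" "isect D canonical = -3" "isect canonical D = -3"
    "isect l l = -1" "isect l canonical = -1" "isect canonical l = -1"
    "isect canonical (canonical :: 'n pic) = N" "isect l D = isect D l"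
    using D l
    by (simp_all add: exceptional_systems_iff pic_lines_def N_def isect_commute[of canonical D] isect_commute[of canonical l]
        isect_commute[of l D])
  have "isect z canonical = 0"
    by (simp add: z_def isect_bilinear)
  then have "isect z z \<le> 0"
    by (rule negative_definite_orthogonal_canonical[rotated]) (use r in simp)
  moreover have "isect z z = N * (N * (- 3 - 4 * isect D l) - 1)"
    by (simp add: z_def isect_bilinear algebra_simps)
  ultimately have "N * (- 3 - 4 * isect D l) \<le> 1"
    using N by (simp add: mult_le_0_iff)
  moreover have "N * 1 \<le> N * (- 3 - 4 * isect D l)"
    using N \<open>\<not> 0 \<le> isect D l\<close> by (intro mult_left_mono) auto
  ultimately show False using N by simp
qed

text \<open>
  With \<open>N = K\<^sup>2\<close>, the class \<open>N (l + m) + 2 K\<close> is orthogonal to \<open>K\<close>, and its square is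
  non-negative as soon as \<open>l \<cdot> m \<ge> 3\<close>; so it vanishes. This is the case \<open>N = 1\<close>,
  \<open>l + m = -2K\<close> of the Bertini involution. What matters below is that \<open>m\<close> is determined by
  \<open>l\<close>.
\<close>

lemma lines_far_apart:
  fixes l m :: "'n::finite pic"
  assumes r: "CARD('n) \<le> 8" and l: "l \<in> pic_lines" and m: "m \<in> pic_lines"
    and far: "3 \<le> isect l m"
  shows "isect canonical (canonical :: 'n pic) *s (l + m) = (-2) *s canonical"
proof -
  define N where "N = isect canonical (canonical :: 'n pic)"
  have N: "1 \<le> N" using r by (simp add: N_def isect_canonical_self)
  define z where "z = N *s (l + m) + 2 *s canonical"
  have [simp]: "isect l l = -1" "isect l canonical = -1" "isect canonical l = -1"
    "isect m m = -1" "isect m canonical = -1" "isect canonical m = -1"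
    "isect canonical (canonical :: 'n pic) = N" "isect m l = isect l m"
    using l m by (simp_all add: pic_lines_def N_def isect_commute[of canonical l]
        isect_commute[of canonical m] isect_commute[of m l])
  have K: "isect z canonical = 0"
    by (simp add: z_def isect_bilinear)
  have "isect z z = N * (N * (2 * isect l m - 2) - 4)"
    by (simp add: z_def isect_bilinear algebra_simps)
  moreover have "1 * 4 \<le> N * (2 * isect l m - 2)"
    using N far by (intro mult_mono) auto
  ultimately have "0 \<le> isect z z" using N by simp
  then have "z = 0"
    using negative_definite_orthogonal_canonical[OF r K] by force
  then have zero: "z $ j = 0" for j by simp
  have "N * (l $ j + m $ j) = - 2 * canonical $ j" for j
    using zero[of j] by (simp add: z_def algebra_simps)
  then show ?thesis
    by (simp add: vec_eq_iff algebra_simps flip: N_def)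
qed

section \<open>Reflections\<close>

definition pic_roots :: "'n::finite pic set" where
  "pic_roots = {d. isect d d = -2 \<and> isect d canonical = 0}"

lemma isect_reflection_left:
  "isect (reflection d x) y = isect x y + isect x d * isect d y"
  by (simp add: reflection_def isect_bilinear)

lemma reflection_isometry:
  assumes "d \<in> pic_roots"
  shows "isect (reflection d x) (reflection d y) = isect x y"
proof -
  have "isect d d = -2" using assms by (simp add: pic_roots_def)
  then show ?thesis
    by (simp add: reflection_def isect_bilinear isect_commute[of d y] algebra_simps)
qed

lemma reflection_isect_canonical:
  assumes "d \<in> pic_roots"
  shows "isect (reflection d x) canonical = isect x canonical"
  using assms by (simp add: pic_roots_def isect_reflection_left)

lemma reflection_involution:
  assumes "d \<in> pic_roots"
  shows "reflection d (reflection d x) = x"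
  using assms
  by (simp add: pic_roots_def reflection_def isect_bilinear vec_eq_iff algebra_simps)

lemma reflection_add: "reflection d (x + y) = reflection d x + reflection d y"
  by (simp add: reflection_def isect_bilinear vec_eq_iff algebra_simps)

lemma reflection_eq_iff:
  assumes "d \<in> pic_roots"
  shows "reflection d x = reflection d y \<longleftrightarrow> x = y"
  by (metis assms reflection_involution)

lemma reflection_preserves:
  assumes "d \<in> pic_roots"
  shows "reflection d x \<in> pic_lines \<longleftrightarrow> x \<in> pic_lines"
    and "reflection d x \<in> exceptional_systems \<longleftrightarrow> x \<in> exceptional_systems"
    and "reflection d x \<in> pic_roots \<longleftrightarrow> x \<in> pic_roots"
  by (simp_all add: pic_lines_def exceptional_systems_iff pic_roots_def
      reflection_isometry[OF assms] reflection_isect_canonical[OF assms])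

lemma exc_in_pic_lines: "exc i \<in> pic_lines"
  by (simp add: pic_lines_def isect_basis isect_basis_canonical)

section \<open>Dominant classes\<close>

text \<open>
  For a class \<open>d h - \<Sum> u\<^sub>i e\<^sub>i\<close> in the Weyl chamber with \<open>u\<^sub>n \<ge> 0\<close>: from the fourth summand on,
  \<open>u\<^sub>i (u\<^sub>i - u\<^sub>3)\<close> is non-positive, and the first two are controlled by \<open>u\<^sub>1 + u\<^sub>2 + u\<^sub>3 \<le> d\<close>. Since
  \<open>\<Sum> u\<^sub>i\<^sup>2\<close> and \<open>\<Sum> u\<^sub>i\<close> are determined by \<open>d\<close> for lines and exceptional systems, this becomes
  a condition on \<open>d\<close>, \<open>u\<^sub>1\<close> and \<open>u\<^sub>3\<close> alone.
\<close>

lemma noether_inequality: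
  fixes u :: "nat \<Rightarrow> int"
  assumes n: "3 \<le> n" and dec: "\<And>i. 1 \<le> i \<Longrightarrow> i < n \<Longrightarrow> u (i + 1) \<le> u i"
    and deg: "u 1 + u 2 + u 3 \<le> d" and nonneg: "0 \<le> u n"
  shows "\<And>i. i \<in> {1..n} \<Longrightarrow> 0 \<le> u i \<and> u i \<le> u 1"
    and "(\<Sum>i=1..n. (u i)\<^sup>2) - u 3 * (\<Sum>i=1..n. u i) \<le> u 1 * (d - 3 * u 3)"
proof -
  have mono: "u j \<le> u i" if "1 \<le> i" "i \<le> j" "j \<le> n" for i j
    using that(2,3,1)
  proof (induction j rule: dec_induct)
    case (step k)
    then show ?case using dec[of k] by simp
  qed simp
  show bounds: "0 \<le> u i \<and> u i \<le> u 1" if "i \<in> {1..n}" for i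
    using mono[of i n] mono[of 1 i] nonneg that by auto
  have split: "{1..n} = {1, 2, 3} \<union> {4..n}" using n by auto
  have "(\<Sum>i=1..n. (u i)\<^sup>2) - u 3 * (\<Sum>i=1..n. u i) = (\<Sum>i=1..n. u i * (u i - u 3))"
    by (simp add: power2_eq_square algebra_simps sum_subtractf sum_distrib_left)
  also have "\<dots> = u 1 * (u 1 - u 3) + u 2 * (u 2 - u 3) + (\<Sum>i=4..n. u i * (u i - u 3))"
    unfolding split by (subst sum.union_disjoint) auto
  also have "(\<Sum>i=4..n. u i * (u i - u 3)) \<le> 0"
    using bounds mono[of 3] by (intro sum_nonpos mult_nonneg_nonpos) auto
  also have "u 1 * (u 1 - u 3) + u 2 * (u 2 - u 3) + 0 \<le> u 1 * (u 1 - u 3) + u 1 * (u 2 - u 3)"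
    using bounds[of 2] mono[of 2 3] n by (simp add: mult_right_mono)
  also have "\<dots> = u 1 * (u 1 + u 2 + u 3 - 3 * u 3)"
    by (simp add: algebra_simps)
  also have "\<dots> \<le> u 1 * (d - 3 * u 3)"
    using deg bounds[of 1] n by (intro mult_left_mono) auto
  finally show "(\<Sum>i=1..n. (u i)\<^sup>2) - u 3 * (\<Sum>i=1..n. u i) \<le> u 1 * (d - 3 * u 3)"
    by simp
qed

locale marked_points =
  fixes p :: "nat \<Rightarrow> 'n::finite"
  assumes three: "3 \<le> CARD('n)" and bij: "bij_betw p {1..CARD('n)} UNIV"
begin

lemma p_eq_iff: "i \<in> {1..CARD('n)} \<Longrightarrow> j \<in> {1..CARD('n)} \<Longrightarrow> p i = p j \<longleftrightarrow> i = j"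
  using bij_betw_imp_inj_on[OF bij] by (simp add: inj_on_eq_iff)

lemma sum_points: "(\<Sum>i\<in>UNIV. f i) = (\<Sum>k=1..CARD('n). f (p k))"
  by (rule sum.reindex_bij_betw[OF bij, symmetric])

lemma isect_self_points:
  "isect D D = (isect D hyp)\<^sup>2 - (\<Sum>k=1..CARD('n). (isect D (exc (p k)))\<^sup>2)"
  by (simp add: isect_self isect_hyp isect_exc sum_points)

lemma isect_canonical_points:
  "isect D canonical = - 3 * isect D hyp + (\<Sum>k=1..CARD('n). isect D (exc (p k)))"
  by (simp add: isect_canonical isect_hyp isect_exc sum_points sum_negf)

lemma first_simple_root: "hyp - exc (p 1) - exc (p 2) - exc (p 3) \<in> simple_roots p"
  by (simp add: simple_roots_def)

lemma other_simple_root: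
  "1 \<le> i \<Longrightarrow> i < CARD('n) \<Longrightarrow> exc (p i) - exc (p (i + 1)) \<in> simple_roots p"
  unfolding simple_roots_def by blast

lemma simple_roots_cases:
  assumes "s \<in> simple_roots p"
  obtains "s = hyp - exc (p 1) - exc (p 2) - exc (p 3)"
  | i where "1 \<le> i" "i < CARD('n)" "s = exc (p i) - exc (p (i + 1))"
  using assms unfolding simple_roots_def by blast

lemma simple_roots_subset: "simple_roots p \<subseteq> pic_roots"
proof
  fix s assume "s \<in> simple_roots p"
  then show "s \<in> pic_roots"
  proof (cases rule: simple_roots_cases)
    case 1
    then show ?thesis using three p_eq_iff[of 1 2] p_eq_iff[of 1 3] p_eq_iff[of 2 3]
      by (simp add: pic_roots_def isect_bilinear isect_basis isect_basis_canonical)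
  next
    case (2 i)
    then show ?thesis using p_eq_iff[of i "i + 1"]
      by (simp add: pic_roots_def isect_bilinear isect_basis isect_basis_canonical)
  qed
qed

text \<open>
  A linear functional that is positive on all simple roots: \<open>1\<close> on \<open>e\<^sub>i - e\<^sub>i\<^sub>+\<^sub>1\<close> and \<open>6\<close> on
  \<open>h - e\<^sub>1 - e\<^sub>2 - e\<^sub>3\<close>. It does not involve the coefficient of \<open>h\<close>, so it is bounded below on any
  set of classes whose intersection numbers with the \<open>e\<^sub>i\<close> are.
\<close>

definition height :: "'n pic \<Rightarrow> int" where
  "height D = (\<Sum>k=1..CARD('n). int k * isect D (exc (p k)))"

lemma height_add: "height (x + y) = height x + height y"
  by (simp add: height_def isect_bilinear algebra_simps sum.distrib)

lemma height_diff: "height (x - y) = height x - height y"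
  by (simp add: height_def isect_bilinear algebra_simps sum_subtractf)

lemma height_scale: "height (c *s x) = c * height x"
  by (simp add: height_def isect_bilinear algebra_simps sum_distrib_left)

lemma height_hyp: "height hyp = 0"
  by (simp add: height_def isect_basis)

lemma height_exc:
  assumes "k \<in> {1..CARD('n)}"
  shows "height (exc (p k)) = - int k"
proof -
  have "height (exc (p k)) = (\<Sum>i=1..CARD('n). if i = k then - int k else 0)"
    unfolding height_def by (intro sum.cong) (use assms in \<open>auto simp: isect_basis p_eq_iff\<close>)
  then show ?thesis using assms by simp
qed

lemma height_simple_root_pos:
  assumes "s \<in> simple_roots p"
  shows "0 < height s"
  using assms
proof (cases rule: simple_roots_cases)
  case 1
  then show ?thesis
    using three height_exc[of 1] height_exc[of 2] height_exc[of 3] by (simp add: height_diff height_hyp)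
next
  case (2 i)
  then show ?thesis
    using height_exc[of i] height_exc[of "i + 1"] by (simp add: height_diff)
qed

lemma height_reflection_less:
  assumes "s \<in> simple_roots p" and "isect D s < 0"
  shows "height (reflection s D) < height D"
  using height_simple_root_pos[OF assms(1)] assms(2)
  by (simp add: reflection_def height_add height_scale mult_neg_pos)

definition dominant :: "'n pic \<Rightarrow> bool" where
  "dominant D \<longleftrightarrow> (\<forall>s\<in>simple_roots p. 0 \<le> isect D s)"

lemma dominantD:
  assumes "dominant D"
  shows "isect D (exc (p 1)) + isect D (exc (p 2)) + isect D (exc (p 3)) \<le> isect D hyp"
    and "1 \<le> i \<Longrightarrow> i < CARD('n) \<Longrightarrow> isect D (exc (p (i + 1))) \<le> isect D (exc (p i))"
  using assms first_simple_root other_simple_root[of i]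
  by (force simp: dominant_def isect_bilinear)+

text \<open>
  Here \<open>\<Sum> u\<^sub>i\<^sup>2 = d\<^sup>2 - 1\<close> and \<open>\<Sum> u\<^sub>i = 3 (d - 1)\<close>. As \<open>u\<^sub>1 \<le> d - 1\<close>, Noether's inequality becomes
  \<open>(d - 1) (d + 1 - 3u\<^sub>3) \<le> (d - 1) (d - 3u\<^sub>3)\<close>, which leaves only \<open>d = 1\<close> and \<open>u = 0\<close>.
\<close>

lemma dominant_exceptional_eq_hyp:
  assumes r: "CARD('n) \<le> 7" and D: "D \<in> exceptional_systems" and dom: "dominant D"
  shows "D = hyp"
proof -
  define u where "u k = isect D (exc (p k))" for k
  define d where "d = isect D hyp"
  have nonneg: "0 \<le> isect D (exc i)" for i
    using exceptional_isect_line_nonneg[OF r D exc_in_pic_lines] .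
  have deg: "u 1 + u 2 + u 3 \<le> d" using dominantD(1)[OF dom] by (simp add: u_def d_def)
  note noether = noether_inequality[of "CARD('n)" u d, OF three]
  have bounds: "0 \<le> u i \<and> u i \<le> u 1" if "i \<in> {1..CARD('n)}" for i
    using that noether(1) deg dominantD(2)[OF dom] nonneg by (simp add: u_def)
  have main: "(\<Sum>i=1..CARD('n). (u i)\<^sup>2) - u 3 * (\<Sum>i=1..CARD('n). u i) \<le> u 1 * (d - 3 * u 3)"
    using noether(2) deg dominantD(2)[OF dom] nonneg by (simp add: u_def)
  have sq: "(\<Sum>i=1..CARD('n). (u i)\<^sup>2) = d\<^sup>2 - 1"
    and lin: "(\<Sum>i=1..CARD('n). u i) = 3 * d - 3"
    using D isect_self_points[of D] isect_canonical_points[of D]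
    by (simp_all add: exceptional_systems_iff u_def d_def)
  have u: "0 \<le> u 2" "0 \<le> u 3" "u 3 \<le> u 1" "0 \<le> u 1" using bounds three by auto
  have "u 1 \<noteq> d"
  proof
    assume "u 1 = d"
    moreover have "(u 1)\<^sup>2 \<le> (\<Sum>i=1..CARD('n). (u i)\<^sup>2)"
      by (rule member_le_sum) (use three in auto)
    ultimately show False using sq by simp
  qed
  then have "u 1 \<le> d - 1" using u deg by simp
  then have "u 1 * (d - 3 * u 3) \<le> (d - 1) * (d - 3 * u 3)"
    using u deg bounds[of 2] dominantD(2)[OF dom, of 2] three
    by (intro mult_right_mono) (auto simp: u_def)
  with main have "(d - 1) * (d + 1 - 3 * u 3) \<le> (d - 1) * (d - 3 * u 3)"
    unfolding sq lin by (simp add: power2_eq_square algebra_simps)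
  then have "d \<le> 1" by (simp add: algebra_simps)
  moreover have "0 \<le> u 1" "u 1 \<le> d - 1" by fact+
  ultimately have d1: "d = 1" by simp
  then have "(\<Sum>i\<in>UNIV. (isect D (exc i))\<^sup>2) = 0"
    using sq by (simp add: sum_points u_def)
  then have "D $ Some i = 0" for i
    by (simp add: sum_nonneg_eq_0_iff isect_exc)
  then have "D $ j = hyp $ j" for j
    using d1 by (cases j) (simp_all add: hyp_nth d_def isect_hyp)
  then show ?thesis by (simp add: vec_eq_iff)
qed

text \<open>
  A line other than \<open>e\<^sub>r\<close> has \<open>u\<^sub>r \<ge> 0\<close>, so Noether's inequality applies; with \<open>\<Sum> u\<^sub>i\<^sup>2 = d\<^sup>2 + 1\<close>,
  \<open>\<Sum> u\<^sub>i = 3d - 1\<close> and \<open>u\<^sub>1 \<le> d\<close> it gives \<open>1 + u\<^sub>3 \<le> 0\<close>.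
\<close>

lemma dominant_line_eq_last_exc:
  assumes r: "CARD('n) \<le> 8" and l: "l \<in> pic_lines" and dom: "dominant l"
  shows "l = exc (p CARD('n))"
proof (rule ccontr)
  assume ne: "l \<noteq> exc (p CARD('n))"
  define u where "u k = isect l (exc (p k))" for k
  define d where "d = isect l hyp"
  have nonneg: "0 \<le> u CARD('n)"
    using distinct_lines_isect_nonneg[OF r l exc_in_pic_lines ne] by (simp add: u_def)
  have deg: "u 1 + u 2 + u 3 \<le> d" using dominantD(1)[OF dom] by (simp add: u_def d_def)
  have dec: "u (i + 1) \<le> u i" if "1 \<le> i" "i < CARD('n)" for i
    using dominantD(2)[OF dom that] by (simp add: u_def)
  note noether = noether_inequality[of "CARD('n)" u d, OF three dec deg nonneg]
  have sq: "(\<Sum>i=1..CARD('n). (u i)\<^sup>2) = d\<^sup>2 + 1"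
    and lin: "(\<Sum>i=1..CARD('n). u i) = 3 * d - 1"
    using l isect_self_points[of l] isect_canonical_points[of l]
    by (simp_all add: pic_lines_def u_def d_def)
  have u: "0 \<le> u 2" "0 \<le> u 3" "u 3 \<le> u 2" "0 \<le> u 1" "u 2 \<le> u 1"
    using noether(1) dec[of 2] three by auto
  have "u 1 * (d - 3 * u 3) \<le> d * (d - 3 * u 3)"
    using u deg by (intro mult_right_mono) auto
  with noether(2) have "1 + u 3 \<le> 0"
    unfolding sq lin by (simp add: power2_eq_square algebra_simps)
  with u show False by simp
qed

text \<open>
  Descent on the height: an exceptional system other than \<open>h\<close> is not dominant, so some simple
  reflection lowers its height, which stays non-negative.
\<close>

lemma exceptional_system_induct [consumes 2, case_names hyp reflection]:
  assumes r: "CARD('n) \<le> 7" and D: "D \<in> exceptional_systems"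
    and base: "Q hyp"
    and step: "\<And>s x. s \<in> simple_roots p \<Longrightarrow> x \<in> exceptional_systems \<Longrightarrow> Q x \<Longrightarrow> Q (reflection s x)"
  shows "Q D"
  using D
proof (induction "nat (height D)" arbitrary: D rule: less_induct)
  case less
  show ?case
  proof (cases "dominant D")
    case True
    then show ?thesis using dominant_exceptional_eq_hyp[OF r less.prems] base by simp
  next
    case False
    then obtain s where s: "s \<in> simple_roots p" "isect D s < 0"
      by (auto simp: dominant_def not_le)
    then have root: "s \<in> pic_roots" using simple_roots_subset by blast
    have E: "reflection s D \<in> exceptional_systems"
      using less.prems by (simp add: reflection_preserves[OF root])
    have "0 \<le> height (reflection s D)"
      unfolding height_def
      by (intro sum_nonneg mult_nonneg_nonneg exceptional_isect_line_nonneg[OF r E exc_in_pic_lines]) simp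
    then have "nat (height (reflection s D)) < nat (height D)"
      using height_reflection_less[OF s] by simp
    from step[OF s(1) E less.hyps[OF this E]] show ?thesis
      by (simp add: reflection_involution[OF root])
  qed
qed

text \<open>
  If no root separates \<open>l\<close> from \<open>m\<close>, they lie in a common Weyl chamber, and moving that chamber to
  the dominant one identifies both with the only dominant line. The chamber is found by descent on
  the height of \<open>l + m\<close>: once \<open>l + m\<close> is dominant and no simple root separates \<open>l\<close> from \<open>m\<close>,
  both are dominant.
\<close>

lemma separating_root:
  fixes l m :: "'n pic"
  assumes r: "CARD('n) \<le> 8" and "l \<in> pic_lines" "m \<in> pic_lines" "l \<noteq> m"
  obtains d where "d \<in> pic_roots" "0 < isect l d" "isect m d < 0"
proof -
  define b where "b = (\<Sum>k=1..CARD('n). int k * 2)"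
  \<comment> \<open>Lines meet each \<open>e\<^sub>i\<close> in at least \<open>-1\<close>, so heights of sums of two lines are at least \<open>-b\<close>.\<close>
  have ge: "- 1 \<le> isect x (exc i)" if "x \<in> pic_lines" for x :: "'n pic" and i
    using distinct_lines_isect_nonneg[OF r that exc_in_pic_lines[of i]]
    by (cases "x = exc i") (auto simp: isect_basis)
  have lower: "0 \<le> height (x + y) + b" if "x \<in> pic_lines" "y \<in> pic_lines" for x y
  proof -
    have "height (x + y) + b
        = (\<Sum>k=1..CARD('n). int k * (isect x (exc (p k)) + isect y (exc (p k)) + 2))"
      by (simp add: height_def b_def isect_bilinear sum.distrib algebra_simps)
    also have "0 \<le> \<dots>"
    proof (intro sum_nonneg mult_nonneg_nonneg)
      fix k show "0 \<le> isect x (exc (p k)) + isect y (exc (p k)) + 2"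
        using ge[OF that(1), of "p k"] ge[OF that(2), of "p k"] by simp
    qed simp
    finally show ?thesis .
  qed
  have "\<exists>d\<in>pic_roots. 0 < isect l d \<and> isect m d < 0"
    using assms(2-4)
  proof (induction "nat (height (l + m) + b)" arbitrary: l m rule: less_induct)
    case less
    show ?case
    proof (cases "dominant (l + m)")
      case True
      show ?thesis
      proof (rule ccontr)
        assume none: "\<not> ?thesis"
        have "0 \<le> isect l s \<and> 0 \<le> isect m s" if s: "s \<in> simple_roots p" for s
        proof -
          have root: "s \<in> pic_roots" using s simple_roots_subset by blast
          then have neg_root: "- s \<in> pic_roots"
            by (simp add: pic_roots_def isect_def sum_negf)
          have neg: "isect x (- s) = - isect x s" for x
            by (simp add: isect_def sum_negf)
          have "0 \<le> isect l s + isect m s"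
            using True s by (simp add: dominant_def isect_bilinear)
          moreover have "\<not> (0 < isect l s \<and> isect m s < 0)" "\<not> (isect l s < 0 \<and> 0 < isect m s)"
            using none root neg_root by (auto simp: neg dest: bspec[where x = "- s"])
          ultimately show ?thesis by linarith
        qed
        then have "dominant l" "dominant m" by (simp_all add: dominant_def)
        then show False
          using dominant_line_eq_last_exc[OF r] less.prems by metis
      qed
    next
      case False
      then obtain s where s: "s \<in> simple_roots p" "isect (l + m) s < 0"
        by (auto simp: dominant_def not_le)
      then have root: "s \<in> pic_roots" using simple_roots_subset by blast
      have lines: "reflection s l \<in> pic_lines" "reflection s m \<in> pic_lines"
        using less.prems by (simp_all add: reflection_preserves[OF root])
      have "nat (height (reflection s l + reflection s m) + b) < nat (height (l + m) + b)"
        using height_reflection_less[OF s] lower[OF lines]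
        by (simp add: reflection_add)
      from less.hyps[OF this lines] less.prems(3)
      obtain d where d: "d \<in> pic_roots" "0 < isect (reflection s l) d" "isect (reflection s m) d < 0"
        by (auto simp: reflection_eq_iff[OF root])
      have "isect x (reflection s d) = isect (reflection s x) d" for x
        using reflection_isometry[OF root, of x "reflection s d"]
        by (simp add: reflection_involution[OF root])
      then show ?thesis
        using d by (intro bexI[of _ "reflection s d"]) (simp_all add: reflection_preserves[OF root])
    qed
  qed
  then show thesis using that by blast
qed

end

section \<open>Contracting skew lines\<close>

lemma real_pic_nth: "real_pic x $ j = real_of_int (x $ j)"
  by (simp add: real_pic_def)

lemma isect_real_pic: "isect (real_pic x) (real_pic y) = real_of_int (isect x y)"
  by (simp add: isect_def real_pic_nth)

lemma real_pic_eq_iff: "real_pic x = real_pic y \<longleftrightarrow> x = y"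
  by (simp add: vec_eq_iff real_pic_nth)

lemma real_pic_diff: "real_pic (x - y) = real_pic x - real_pic y"
  by (simp add: vec_eq_iff real_pic_nth)

lemma isect_scaleR_left: "isect (c *\<^sub>R x) z = c * isect x z"
  using isect_scale_left[of c x z] by (simp add: scalar_mult_eq_scaleR)

lemma isect_scaleR_right: "isect z (c *\<^sub>R x) = c * isect z x"
  by (metis isect_commute isect_scaleR_left)

text \<open>
  Orthogonal vectors of nonzero square are linearly independent even for an indefinite form, so
  \<open>B\<close> is a basis, and the form is nondegenerate.
\<close>

lemma orthogonal_complement_basis_zero:
  fixes B :: "'n::finite rpic set"
  assumes card: "card B = CARD('n) + 1" and orth: "pairwise (\<lambda>x y. isect x y = 0) B"
    and nonzero: "\<And>b. b \<in> B \<Longrightarrow> isect b b \<noteq> 0" and y: "\<And>b. b \<in> B \<Longrightarrow> isect y b = 0"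
  shows "y = 0"
proof -
  have fin: "finite B" using card by (intro card_ge_0_finite) simp
  have "independent B"
  proof (rule independent_if_scalars_zero[OF fin])
    fix f b assume sum0: "(\<Sum>x\<in>B. f x *\<^sub>R x) = 0" and b: "b \<in> B"
    have "0 = isect (\<Sum>x\<in>B. f x *\<^sub>R x) b"
      by (simp only: sum0 isect_zero_left)
    also have "\<dots> = (\<Sum>x\<in>B. if x = b then f b * isect b b else 0)"
      unfolding isect_sum_left isect_scaleR_left
      using orth b by (intro sum.cong) (auto simp: pairwise_def)
    also have "\<dots> = f b * isect b b" using fin b by simp
    finally show "f b = 0" using nonzero[OF b] by simp
  qed
  then have "UNIV \<subseteq> span B"
    by (intro card_ge_dim_independent) (simp_all add: card)
  moreover have "subspace {z. isect y z = 0}"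
    by (rule subspaceI) (simp_all add: isect_add_right isect_scaleR_right isect_zero_right)
  then have "span B \<subseteq> {z. isect y z = 0}"
    using y by (intro span_minimal) auto
  ultimately have zero: "isect y z = 0" for z by blast
  have "y $ j = 0" for j
  proof (cases j)
    case None
    then show ?thesis using zero[of "axis None 1"] by (simp add: isect_def axis_def)
  next
    case (Some i)
    then show ?thesis using zero[of "axis (Some i) 1"]
      by (simp add: isect_def axis_def if_distrib cong: if_cong)
  qed
  then show ?thesis by (simp add: vec_eq_iff)
qed

text \<open>
  Contracting the lines of \<open>A\<close> gives a projective plane, whose canonical class pulls back to
  \<open>K - \<Sum>A\<close>, three times the negative of the class of a line. The lattice proof that
  \<open>v = \<Sum>A - K\<close> is divisible by \<open>3\<close>: the lines of \<open>A\<close> and \<open>v\<close> form an orthogonal basis over the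
  reals, so \<open>9 (x + \<Sum>\<^sub>l (x \<cdot> l) l) = (x \<cdot> v) v\<close> for every class \<open>x\<close>. Taking \<open>x\<close> among \<open>h\<close> and the
  \<open>e\<^sub>i\<close> and comparing the coefficients at that basis vector shows that \<open>9\<close> divides the square of
  each coefficient of \<open>v\<close>.
\<close>

lemma skew_lines_sum:
  fixes A :: "'n::finite pic set"
  assumes A: "A \<subseteq> pic_lines" and card: "card A = CARD('n)"
    and skew: "pairwise (\<lambda>l m. isect l m = 0) A"
  obtains D where "D \<in> exceptional_systems" "canonical + 3 *s D = (\<Sum>l\<in>A. l)"
proof -
  have fin: "finite A" using card by (intro card_ge_0_finite) simp
  have line: "isect l l = -1" "isect l canonical = -1" "isect canonical l = -1" if "l \<in> A" for l
    using that A by (auto simp: pic_lines_def isect_commute[of canonical l])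
  have pick: "(\<Sum>l\<in>A. f l * isect l m) = - f m" if "m \<in> A" for f m
  proof -
    have "(\<Sum>l\<in>A. f l * isect l m) = (\<Sum>l\<in>A. if l = m then - f m else 0)"
      using skew that line by (intro sum.cong) (auto simp: pairwise_def)
    then show ?thesis using fin that by simp
  qed
  define v where "v = (\<Sum>l\<in>A. l) - canonical"
  have v_line: "isect v m = 0" if "m \<in> A" for m
    using pick[OF that, of "\<lambda>_. 1"] line[OF that] by (simp add: v_def isect_bilinear)
  then have line_v: "isect m v = 0" if "m \<in> A" for m
    using that by (metis isect_commute)
  have v_can: "isect v canonical = -9"
    by (simp add: v_def isect_bilinear line isect_canonical_self card)
  have v_self: "isect v v = 9"
  proof -
    have "isect v ((\<Sum>l\<in>A. l) - canonical) = (\<Sum>l\<in>A. isect v l) - isect v canonical"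
      by (simp add: isect_bilinear)
    then have "isect v v = (\<Sum>l\<in>A. isect v l) - isect v canonical"
      by (simp flip: v_def)
    then show ?thesis by (simp add: v_line v_can)
  qed
  have expand: "9 *s (x + (\<Sum>l\<in>A. isect x l *s l)) = isect x v *s v" for x
  proof -
    define y where "y = 9 *s (x + (\<Sum>l\<in>A. isect x l *s l)) - isect x v *s v"
    have y_line: "isect y m = 0" if "m \<in> A" for m
      using pick[OF that, of "isect x"] by (simp add: y_def isect_bilinear v_line[OF that])
    have y_v: "isect y v = 0"
      by (simp add: y_def isect_bilinear line_v v_self)
    define B where "B = insert (real_pic v) (real_pic ` A)"
    have "v \<notin> A" using v_self line(1) by force
    then have cardB: "card B = CARD('n) + 1"
      using fin card by (simp add: B_def card_image inj_on_def real_pic_eq_iff image_iff)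
    have "real_pic y = 0"
    proof (rule orthogonal_complement_basis_zero[OF cardB])
      show "pairwise (\<lambda>x y. isect x y = 0) B"
        using skew by (auto simp: B_def pairwise_def isect_real_pic real_pic_eq_iff v_line line_v)
    qed (auto simp: B_def isect_real_pic v_self line y_line y_v)
    then have "y = 0" by (simp add: vec_eq_iff real_pic_nth)
    then show ?thesis by (simp add: y_def)
  qed
  have "3 dvd v $ j" for j
  proof -
    define x :: "'n pic" where "x = axis j 1"
    have x: "x $ j = 1" by (simp add: x_def)
    have "isect v x = v $ j \<or> isect v x = - v $ j"
    proof (cases j)
      case None
      then have "x = hyp" by (simp add: x_def hyp_def)
      then show ?thesis by (simp add: None isect_hyp)
    next
      case (Some i)
      then have "x = exc i" by (simp add: x_def exc_def)
      then show ?thesis by (simp add: Some isect_exc)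
    qed
    then have "isect x v = v $ j \<or> isect x v = - v $ j"
      by (simp add: isect_commute[of x v])
    then have "isect x v * v $ j = v $ j * v $ j \<or> isect x v * v $ j = - (v $ j * v $ j)"
      by auto
    moreover have "isect x v * v $ j = 9 * (x + (\<Sum>l\<in>A. isect x l *s l)) $ j"
      using arg_cong[OF expand[of x], of "\<lambda>z. z $ j"] by simp
    then have "9 dvd isect x v * v $ j" by (rule dvdI)
    ultimately have "9 dvd v $ j * v $ j" by auto
    then have "(3::int)\<^sup>2 dvd (v $ j)\<^sup>2" by (simp add: power2_eq_square)
    then show ?thesis by (simp only: pow_divides_pow_iff)
  qed
  then have v3: "v = 3 *s (\<chi> j. v $ j div 3)"
    by (simp add: vec_eq_iff)
  define D where "D = (\<chi> j. v $ j div 3)"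
  have v: "v = 3 *s D" using v3 by (simp add: D_def)
  have "D \<in> exceptional_systems"
    using v_self v_can by (simp add: v exceptional_systems_iff isect_bilinear)
  moreover have "canonical + 3 *s D = (\<Sum>l\<in>A. l)"
    by (simp add: v_def flip: v)
  ultimately show thesis by (rule that)
qed

section \<open>Simplex facets of the Gosset polytope\<close>

text \<open>
  Along the segment from \<open>l\<close> to \<open>m\<close> the square is \<open>-1 + 2t (1 - t) (1 + l \<cdot> m)\<close>, which exceeds
  \<open>-1\<close> in the interior: the lines lie on a strictly convex quadric.
\<close>

lemma line_in_segment:
  fixes l m a :: "'n::finite pic"
  assumes r: "CARD('n) \<le> 8" and "l \<in> pic_lines" "m \<in> pic_lines" "a \<in> pic_lines" "l \<noteq> m"
    and seg: "real_pic a \<in> closed_segment (real_pic l) (real_pic m)"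
  shows "a = l \<or> a = m"
proof -
  obtain t where t: "real_pic a = (1 - t) *\<^sub>R real_pic l + t *\<^sub>R real_pic m"
    using seg by (auto simp: in_segment)
  define c where "c = real_of_int (isect l m)"
  have c: "0 \<le> c"
    using distinct_lines_isect_nonneg[OF r assms(2,3,5)] by (simp add: c_def)
  have [simp]: "isect (real_pic a) (real_pic a) = -1" "isect (real_pic l) (real_pic l) = -1"
    "isect (real_pic m) (real_pic m) = -1" "isect (real_pic l) (real_pic m) = c"
    "isect (real_pic m) (real_pic l) = c"
    using assms(2-4) by (simp_all add: isect_real_pic pic_lines_def c_def isect_commute[of m l])
  have "-1 = isect ((1 - t) *\<^sub>R real_pic l + t *\<^sub>R real_pic m) ((1 - t) *\<^sub>R real_pic l + t *\<^sub>R real_pic m)"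
    by (simp flip: t)
  also have "\<dots> = - 1 + 2 * t * (1 - t) * (1 + c)"
    unfolding isect_add_left isect_add_right isect_scaleR_left isect_scaleR_right
    by (simp add: algebra_simps)
  finally have "t = 0 \<or> t = 1" using c by simp
  then show ?thesis using t by (auto simp: real_pic_eq_iff)
qed

text \<open>
  Let \<open>d\<close> be a separating root with \<open>l \<cdot> d = j > 0\<close> and \<open>m \<cdot> d = -k < 0\<close>. The lines \<open>a = l + j d\<close>
  and \<open>b = m - k d\<close> satisfy \<open>k a + j b = k l + j m\<close>, so a point of the edge lies between \<open>a\<close> and
  \<open>b\<close>, and the face property puts \<open>a\<close> on the edge. Hence \<open>a = m\<close> and \<open>l \<cdot> m = j\<^sup>2 - 1\<close>.
\<close>

lemma (in marked_points) edge_isect: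
  fixes l m :: "'n pic"
  assumes r: "CARD('n) \<le> 8" and l: "l \<in> pic_lines" and m: "m \<in> pic_lines" and ne: "l \<noteq> m"
    and edge: "closed_segment (real_pic l) (real_pic m) face_of gosset_polytope"
  shows "isect l m = 0 \<or> 3 \<le> isect l m"
proof -
  obtain d where d: "d \<in> pic_roots" "0 < isect l d" "isect m d < 0"
    by (rule separating_root[OF r l m ne])
  define j k where "j = isect l d" and "k = - isect m d"
  have pos: "0 < j" "0 < k" using d by (simp_all add: j_def k_def)
  define a b where "a = reflection d l" and "b = reflection d m"
  have a: "a = l + j *s d" and b: "b = m - k *s d"
    by (simp_all add: a_def b_def reflection_def j_def k_def vec_eq_iff)
  have lines: "a \<in> pic_lines" "b \<in> pic_lines"
    using l m by (simp_all add: a_def b_def reflection_preserves[OF d(1)])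
  define t where "t = real_of_int j / real_of_int (j + k)"
  have t: "0 < t" "t < 1" using pos by (simp_all add: t_def)
  \<comment> \<open>The common point \<open>(k l + j m) / (j + k) = (k a + j b) / (j + k)\<close> of the two segments.\<close>
  define z where "z = (1 - t) *\<^sub>R real_pic l + t *\<^sub>R real_pic m"
  have z_ab: "z = (1 - t) *\<^sub>R real_pic a + t *\<^sub>R real_pic b"
  proof -
    have "(1 - t) * real_of_int j = t * real_of_int k"
      using pos by (simp add: t_def field_simps)
    then have balance: "((1 - t) * real_of_int j) * x = (t * real_of_int k) * x" for x
      by simp
    have "z $ i = ((1 - t) *\<^sub>R real_pic a + t *\<^sub>R real_pic b) $ i" for i
      using balance[of "real_of_int (d $ i)"]
      by (simp add: z_def a b real_pic_nth algebra_simps)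
    then show ?thesis unfolding vec_eq_iff by blast
  qed
  have z: "z \<in> closed_segment (real_pic l) (real_pic m)"
    using t unfolding z_def in_segment by (intro exI[of _ t]) simp
  have "real_pic a \<in> closed_segment (real_pic l) (real_pic m)"
  proof (cases "a = b")
    case True
    then have "z = real_pic a" unfolding z_ab by (simp flip: scaleR_left.add)
    then show ?thesis using z by simp
  next
    case False
    then have "z \<in> open_segment (real_pic a) (real_pic b)"
      using t unfolding z_ab in_segment by (auto simp: real_pic_eq_iff)
    moreover have "real_pic a \<in> gosset_polytope" "real_pic b \<in> gosset_polytope"
      using lines by (auto simp: gosset_polytope_def intro: hull_inc)
    ultimately show ?thesis
      using edge z by (auto dest: face_ofD)
  qed
  then have "a = l \<or> a = m"
    by (rule line_in_segment[OF r l m lines(1) ne])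
  moreover have "isect a d \<noteq> isect l d"
    using d pos by (simp add: a isect_bilinear pic_roots_def)
  ultimately have "m = l + j *s d" using a by auto
  then have "isect l m = j * j - 1"
    using l by (simp add: isect_bilinear pic_lines_def j_def)
  moreover have "j = 1 \<or> 2 * 2 \<le> j * j"
    using pos mult_mono[of 2 j 2 j] by (cases "j = 1") auto
  ultimately show ?thesis by auto
qed

text \<open>
  The edges of a simplex facet are edges of the polytope, so any two vertices \<open>l\<close>, \<open>m\<close> have
  \<open>l \<cdot> m = 0\<close> or \<open>l \<cdot> m \<ge> 3\<close>. In the second case regularity gives \<open>l \<cdot> k \<ge> 3\<close> for a third vertex
  \<open>k\<close> too, and both \<open>m\<close> and \<open>k\<close> are the unique line that far from \<open>l\<close>.
\<close>

lemma (in marked_points) simplex_facet_vertices: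
  fixes F :: "'n rpic set"
  assumes r: "CARD('n) \<le> 8" and F: "F \<in> gosset_simplices"
  obtains A :: "'n pic set" where "A \<subseteq> pic_lines" "card A = CARD('n)"
    "real_pic ` A = {v. v extreme_point_of F}" "pairwise (\<lambda>l m. isect l m = 0) A"
proof -
  note simplex = F[unfolded gosset_simplices_def mem_Collect_eq]
  have face: "F facet_of gosset_polytope" by (rule conjunct1[OF simplex])
  obtain C s where C: "\<not> affine_dependent C \<and> card C = CARD('n) \<and> F = convex hull C \<and>
      (\<forall>x\<in>C. \<forall>y\<in>C. x \<noteq> y \<longrightarrow> pic_dist x y = s)"
    using conjunct2[OF simplex] by (elim exE)
  then have indep: "\<not> affine_dependent C" and card: "card C = CARD('n)" and FC: "F = convex hull C"
    by simp_all
  have dist: "pic_dist x y = s" if "x \<in> C" "y \<in> C" "x \<noteq> y" for x y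
    using C that by simp
  have F_face: "F face_of gosset_polytope" using face by (simp add: facet_of_def)
  have extreme: "{v. v extreme_point_of F} = C"
    using extreme_point_of_convex_hull_affine_independent[OF indep] by (auto simp: FC)
  have C_lines: "C \<subseteq> real_pic ` pic_lines"
  proof
    fix v assume "v \<in> C"
    then have "v extreme_point_of gosset_polytope"
      using extreme extreme_point_of_face[OF F_face] by blast
    then show "v \<in> real_pic ` pic_lines"
      unfolding gosset_polytope_def by (rule extreme_point_of_convex_hull)
  qed
  define A where "A = {l \<in> pic_lines. real_pic l \<in> C}"
  have A: "A \<subseteq> pic_lines" by (auto simp: A_def)
  have image: "real_pic ` A = C" using C_lines by (auto simp: A_def)
  have inj: "inj_on real_pic A" by (simp add: inj_on_def real_pic_eq_iff)
  have cardA: "card A = CARD('n)" using card_image[OF inj] image card by simp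
  have equidistant: "isect l m = isect l' m'"
    if "l \<in> A" "m \<in> A" "l \<noteq> m" "l' \<in> A" "m' \<in> A" "l' \<noteq> m'" for l m l' m'
  proof -
    have sq_dist: "pic_dist (real_pic x) (real_pic y) = sqrt (real_of_int (2 + 2 * isect x y))"
      if "x \<in> A" "y \<in> A" for x y
    proof -
      have "isect x x = -1" "isect y y = -1"
        using that by (simp_all add: A_def pic_lines_def)
      then have "isect (x - y) (x - y) = - (2 + 2 * isect x y)"
        by (simp add: isect_bilinear isect_commute[of y x])
      then show ?thesis
        by (simp only: pic_dist_def isect_real_pic flip: real_pic_diff) simp
    qed
    have in_C: "real_pic x \<in> C" if "x \<in> A" for x using that by (simp add: A_def)
    have "pic_dist (real_pic l) (real_pic m) = s" "pic_dist (real_pic l') (real_pic m') = s"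
      using that by (auto intro!: dist in_C simp: real_pic_eq_iff)
    then have "sqrt (real_of_int (2 + 2 * isect l m)) = sqrt (real_of_int (2 + 2 * isect l' m'))"
      using sq_dist[OF that(1,2)] sq_dist[OF that(4,5)] by simp
    then show ?thesis unfolding real_sqrt_eq_iff by simp
  qed
  have "isect l m = 0" if lm: "l \<in> A" "m \<in> A" "l \<noteq> m" for l m
  proof (rule ccontr)
    assume nonzero: "isect l m \<noteq> 0"
    have lines: "l \<in> pic_lines" "m \<in> pic_lines" and in_C: "real_pic l \<in> C" "real_pic m \<in> C"
      using lm by (simp_all add: A_def)
    have "convex hull {real_pic l, real_pic m} face_of convex hull C"
    proof (rule iffD2[OF face_of_convex_hull_affine_independent[OF indep]])
      show "\<exists>c\<subseteq>C. convex hull {real_pic l, real_pic m} = convex hull c"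
        using in_C by (intro exI[of _ "{real_pic l, real_pic m}"]) simp
    qed
    then have "closed_segment (real_pic l) (real_pic m) face_of F"
      by (simp only: FC segment_convex_hull)
    then have "closed_segment (real_pic l) (real_pic m) face_of gosset_polytope"
      by (rule face_of_trans[OF _ F_face])
    then have far: "3 \<le> isect l m"
      using edge_isect[OF r lines lm(3)] nonzero by simp
    have "\<not> A \<subseteq> {l, m}"
      using card_mono[of "{l, m}" A] cardA three lm by auto
    then obtain k where k: "k \<in> A" "k \<noteq> l" "k \<noteq> m" by blast
    have far': "3 \<le> isect l k"
      using equidistant[of l k l m] lm k far by simp
    define N where "N = isect canonical (canonical :: 'n pic)"
    have "k \<in> pic_lines" using k(1) by (simp add: A_def)
    then have "N *s (l + m) = N *s (l + k)"
      using lines_far_apart[OF r lines far] lines_far_apart[OF r lines(1) _ far']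
      by (simp add: N_def)
    moreover have "N \<noteq> 0" using r by (simp add: N_def isect_canonical_self)
    ultimately have "m = k" by (simp add: vec_eq_iff)
    with k show False by simp
  qed
  then have "pairwise (\<lambda>l m. isect l m = 0) A" by (simp add: pairwise_def)
  then show thesis using that[OF A cardA] image extreme by simp
qed

section \<open>The Weyl group action\<close>

lemma carrier_BijGroup_UNIV: "carrier (BijGroup UNIV) = {f. bij f}"
  by (simp add: BijGroup_def Bij_def)

lemma mult_BijGroup_UNIV: "bij f \<Longrightarrow> bij g \<Longrightarrow> f \<otimes>\<^bsub>BijGroup UNIV\<^esub> g = f \<circ> g"
  by (simp add: BijGroup_def Bij_def compose_def comp_def restrict_def)

lemma one_BijGroup_UNIV: "\<one>\<^bsub>BijGroup UNIV\<^esub> = id"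
  by (simp add: BijGroup_def id_def restrict_def)

lemma inv_BijGroup_UNIV: "bij f \<Longrightarrow> inv\<^bsub>BijGroup UNIV\<^esub> f = inv_into UNIV f"
  by (simp add: inv_BijGroup Bij_def restrict_def)

text \<open>
  It suffices to reach every point of \<open>E\<close> from one base point \<open>e\<close>. Stability is required as an
  equivalence because then each \<open>w\<close>, being a bijection of the whole type, restricts to a bijection
  of \<open>E\<close>.
\<close>

lemma transitive_action_restrict:
  assumes H: "subgroup H (BijGroup UNIV)"
    and stable: "\<And>w x. w \<in> H \<Longrightarrow> w x \<in> E \<longleftrightarrow> x \<in> E"
    and base: "\<And>x. x \<in> E \<Longrightarrow> \<exists>w\<in>H. w e = x"
  shows "transitive_action ((BijGroup UNIV)\<lparr>carrier := H\<rparr>) E (\<lambda>w. restrict w E)"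
proof -
  let ?G = "(BijGroup UNIV)\<lparr>carrier := H\<rparr>"
  have bij: "bij w" if "w \<in> H" for w
    using subgroup.subset[OF H] that by (auto simp: carrier_BijGroup_UNIV)
  have Bij: "restrict w E \<in> Bij E" if w: "w \<in> H" for w
  proof -
    have "w ` E = E"
    proof (intro equalityI subsetI)
      fix x assume x: "x \<in> E"
      obtain y where "x = w y" using bij[OF w] by (metis bij_pointE)
      then show "x \<in> w ` E" using stable[OF w] x by auto
    qed (use stable[OF w] in auto)
    then have "bij_betw w E E"
      using bij[OF w] by (auto simp: bij_betw_def bij_def intro: inj_on_subset)
    then show ?thesis by (simp add: Bij_def cong: bij_betw_cong)
  qed
  have "group ?G" using group.subgroup_imp_group[OF group_BijGroup H] .
  moreover have "(\<lambda>w. restrict w E) \<in> hom ?G (BijGroup E)"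
  proof (rule homI)
    fix w assume "w \<in> carrier ?G"
    then show "restrict w E \<in> carrier (BijGroup E)" using Bij by (simp add: BijGroup_def)
  next
    fix v w assume "v \<in> carrier ?G" "w \<in> carrier ?G"
    then have vw: "v \<in> H" "w \<in> H" by simp_all
    then have "v \<otimes>\<^bsub>?G\<^esub> w = v \<circ> w" using mult_BijGroup_UNIV[OF bij bij] by simp
    then show "restrict (v \<otimes>\<^bsub>?G\<^esub> w) E = restrict v E \<otimes>\<^bsub>BijGroup E\<^esub> restrict w E"
      using vw Bij stable[OF vw(2)] by (auto simp: BijGroup_def compose_def fun_eq_iff)
  qed
  ultimately have "group_hom ?G (BijGroup E) (\<lambda>w. restrict w E)"
    by (simp add: group_hom_def group_hom_axioms_def group_BijGroup)
  moreover have "\<exists>w\<in>H. restrict w E x = y" if xy: "x \<in> E" "y \<in> E" for x y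
  proof -
    obtain v w where vw: "v \<in> H" "v e = x" "w \<in> H" "w e = y" using base xy by meson
    have "inv\<^bsub>BijGroup UNIV\<^esub> v = inv_into UNIV v" using bij[OF vw(1)] by (rule inv_BijGroup_UNIV)
    then have "inv_into UNIV v \<in> H" using subgroup.m_inv_closed[OF H vw(1)] by simp
    then have "w \<circ> inv_into UNIV v \<in> H"
      using subgroup.m_closed[OF H vw(3)] mult_BijGroup_UNIV bij vw(3) by metis
    moreover have "restrict (w \<circ> inv_into UNIV v) E x = y"
      using vw xy bij[OF vw(1)] by (metis bij_inv_eq_iff comp_apply restrict_apply')
    ultimately show ?thesis by blast
  qed
  ultimately show ?thesis
    by (simp add: transitive_action_def transitive_action_axioms_def group_action_def)
qed

context marked_points begin

lemma bij_simple_reflection: "s \<in> simple_roots p \<Longrightarrow> bij (reflection s)"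
  using simple_roots_subset reflection_involution by (intro involuntory_imp_bij) blast

lemma weyl_subgroup: "subgroup (carrier (weyl_group p)) (BijGroup UNIV)"
proof -
  have "reflection ` simple_roots p \<subseteq> carrier (BijGroup UNIV)"
    by (auto simp: carrier_BijGroup_UNIV bij_simple_reflection)
  then show ?thesis
    unfolding weyl_group_def using group.generate_is_subgroup[OF group_BijGroup] by simp
qed

lemma weyl_preserves_exceptional:
  assumes "w \<in> carrier (weyl_group p)"
  shows "w x \<in> exceptional_systems \<longleftrightarrow> x \<in> exceptional_systems"
proof -
  have inv_refl: "inv_into UNIV (reflection s) = reflection s" if "s \<in> simple_roots p" for s
    using simple_roots_subset reflection_involution that by (intro inv_equality) blast+
  have "bij w \<and> (\<forall>x. w x \<in> exceptional_systems \<longleftrightarrow> x \<in> exceptional_systems)"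
    using assms unfolding weyl_group_def
  proof simp
    assume "w \<in> generate (BijGroup UNIV) (reflection ` simple_roots p)"
    then show ?thesis
    proof (induction rule: generate.induct)
      case one
      show ?case unfolding one_BijGroup_UNIV by (rule conjI[OF bij_id]) simp
    next
      case (eng v w)
      then have "v \<otimes>\<^bsub>BijGroup UNIV\<^esub> w = v \<circ> w" by (simp add: mult_BijGroup_UNIV)
      then show ?case using eng bij_comp[of w v] by (simp add: comp_def)
    qed (use simple_roots_subset in \<open>auto simp: one_BijGroup_UNIV inv_BijGroup_UNIV
      bij_simple_reflection inv_refl reflection_preserves\<close>)
  qed
  then show ?thesis by blast
qed

lemma exceptional_in_weyl_orbit:
  assumes "CARD('n) \<le> 7" and "D \<in> exceptional_systems"
  shows "\<exists>w\<in>carrier (weyl_group p). w hyp = D"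
  using assms
proof (induction rule: exceptional_system_induct)
  case hyp
  have "id \<in> carrier (weyl_group p)"
    using subgroup.one_closed[OF weyl_subgroup] by (simp add: one_BijGroup_UNIV)
  then show ?case by (rule bexI[rotated]) simp
next
  case (reflection s x)
  then obtain w where w: "w \<in> carrier (weyl_group p)" "w hyp = x" by blast
  have s: "reflection s \<in> carrier (weyl_group p)"
    using reflection(1) by (simp add: weyl_group_def generate.incl)
  have "bij w" using subgroup.subset[OF weyl_subgroup] w by (auto simp: carrier_BijGroup_UNIV)
  then have "reflection s \<circ> w \<in> carrier (weyl_group p)"
    using subgroup.m_closed[OF weyl_subgroup s w(1)] bij_simple_reflection[OF reflection(1)]
    by (simp add: mult_BijGroup_UNIV)
  then show ?case using w by (intro bexI[of _ "reflection s \<circ> w"]) simp_all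
qed

lemma exceptional_transitive:
  assumes "CARD('n) \<le> 7"
  shows "transitive_action (weyl_group p) exceptional_systems (\<lambda>w. restrict w exceptional_systems)"
proof -
  have "transitive_action ((BijGroup UNIV)\<lparr>carrier := carrier (weyl_group p)\<rparr>)
      exceptional_systems (\<lambda>w. restrict w exceptional_systems)"
  proof (rule transitive_action_restrict)
    show "\<exists>w\<in>carrier (weyl_group p). w hyp = D" if "D \<in> exceptional_systems" for D
      using exceptional_in_weyl_orbit[OF assms that] .
  qed (use weyl_subgroup weyl_preserves_exceptional in auto)
  then show ?thesis by (simp add: weyl_group_def)
qed

lemma reflection_sum: "reflection d (\<Sum>x\<in>A. f x) = (\<Sum>x\<in>A. reflection d (f x))"
  by (simp add: reflection_def isect_bilinear sum.distrib vec_eq_iff sum_distrib_right)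

text \<open>
  For \<open>D = h\<close> the lines are \<open>e\<^sub>1, \<dots>, e\<^sub>r\<close>; a simple reflection carries the lines belonging to \<open>D\<close>
  to lines belonging to its reflection.
\<close>

lemma canonical_plus_exceptional_skew:
  assumes "CARD('n) \<le> 7" and "D \<in> exceptional_systems"
  shows "canonical + 3 *s D \<in> (skew_lines :: 'n pic set)"
  using assms
proof (induction rule: exceptional_system_induct)
  case hyp
  have inj: "inj (exc :: 'n \<Rightarrow> 'n pic)"
  proof (rule injI)
    fix i j :: 'n
    assume "exc i = (exc j :: 'n pic)"
    then have "exc i $ Some j = (exc j :: 'n pic) $ Some j" by simp
    then show "i = j" by (simp add: exc_nth split: if_splits)
  qed
  have "canonical + 3 *s hyp = (\<Sum>i\<in>UNIV. exc i :: 'n pic)"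
    by (simp add: canonical_def vec_eq_iff)
  also have "\<dots> = (\<Sum>l\<in>range exc. l)"
    by (simp add: sum.reindex[OF inj])
  finally show ?case
    unfolding skew_lines_def using card_image[OF inj]
    by (auto simp: exc_in_pic_lines isect_basis pairwise_def intro!: exI[of _ "range exc"])
next
  case (reflection s x)
  then have root: "s \<in> pic_roots" using simple_roots_subset by blast
  from reflection(3) obtain A where A: "A \<subseteq> pic_lines" "card A = CARD('n)"
    "pairwise (\<lambda>l m. isect l m = 0) A" "canonical + 3 *s x = (\<Sum>l\<in>A. l)"
    unfolding skew_lines_def by blast
  have inj: "inj_on (reflection s) A" by (simp add: inj_on_def reflection_eq_iff[OF root])
  have "reflection s canonical = canonical"
    using root by (simp add: reflection_def pic_roots_def isect_commute[of canonical s])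
  then have "canonical + 3 *s reflection s x = reflection s (canonical + 3 *s x)"
    by (simp add: reflection_add) (simp add: reflection_def isect_bilinear vec_eq_iff algebra_simps)
  also have "\<dots> = (\<Sum>l\<in>reflection s ` A. l)"
    unfolding A(4) by (simp add: reflection_sum sum.reindex[OF inj])
  finally have sum: "canonical + 3 *s reflection s x = (\<Sum>l\<in>reflection s ` A. l)" .
  have "reflection s ` A \<subseteq> pic_lines"
    using A(1) by (auto simp: reflection_preserves[OF root])
  moreover have "card (reflection s ` A) = CARD('n)" using A(2) by (simp add: card_image[OF inj])
  moreover have "pairwise (\<lambda>l m. isect l m = 0) (reflection s ` A)"
    using A(3) by (auto simp: pairwise_def reflection_isometry[OF root] reflection_eq_iff[OF root])
  ultimately show ?case unfolding skew_lines_def using sum by blast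
qed

lemma exceptional_bij_skew_lines:
  assumes "CARD('n) \<le> 7"
  shows "bij_betw (\<lambda>D. canonical + 3 *s D) exceptional_systems (skew_lines :: 'n pic set)"
proof (rule bij_betw_imageI)
  show "inj_on (\<lambda>D. canonical + 3 *s D) (exceptional_systems :: 'n pic set)"
    by (rule inj_onI) (simp add: vec_eq_iff)
  show "(\<lambda>D. canonical + 3 *s D) ` exceptional_systems = (skew_lines :: 'n pic set)"
  proof (intro equalityI subsetI)
    fix x :: "'n pic" assume "x \<in> skew_lines"
    then obtain A where A: "A \<subseteq> pic_lines" "card A = CARD('n)"
      "pairwise (\<lambda>l m. isect l m = 0) A" and x: "x = (\<Sum>l\<in>A. l)"
      unfolding skew_lines_def by blast
    from skew_lines_sum[OF A] obtain D where "D \<in> exceptional_systems" "canonical + 3 *s D = x"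
      unfolding x .
    then show "x \<in> (\<lambda>D. canonical + 3 *s D) ` exceptional_systems" by blast
  qed (use canonical_plus_exceptional_skew[OF assms] in blast)
qed

end

theorem theorem12:
  fixes r :: nat and p :: "nat \<Rightarrow> 'n::finite"
  assumes "3 \<le> r" and "r \<le> 8"
    and "bij_betw p {1..r} UNIV"
  shows "(\<forall>F \<in> (gosset_simplices :: 'n rpic set set).
            \<exists>A \<subseteq> (pic_lines :: 'n pic set). card A = r \<and>
              real_pic ` A = {v. v extreme_point_of F} \<and>
              (\<exists>D \<in> exceptional_systems. canonical + 3 *s D = (\<Sum>l\<in>A. l))) \<and>
         (r \<le> 7 \<longrightarrow>
            transitive_action (weyl_group p) (exceptional_systems :: 'n pic set)
              (\<lambda>w. restrict w exceptional_systems) \<and>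
            bij_betw (\<lambda>D. canonical + 3 *s D)
              (exceptional_systems :: 'n pic set) skew_lines)"
proof -
  have card: "CARD('n) = r"
    using bij_betw_same_card[OF assms(3)] by simp
  interpret marked_points p
    by standard (use assms in \<open>simp_all add: card\<close>)
  have r: "CARD('n) \<le> 8" using assms(2) by (simp add: card)
  show ?thesis
  proof (intro conjI ballI impI)
    fix F :: "'n rpic set" assume "F \<in> gosset_simplices"
    then obtain A :: "'n pic set" where A: "A \<subseteq> pic_lines" "card A = CARD('n)"
      "real_pic ` A = {v. v extreme_point_of F}" "pairwise (\<lambda>l m. isect l m = 0) A"
      using simplex_facet_vertices[OF r] by blast
    obtain D where "D \<in> exceptional_systems" "canonical + 3 *s D = (\<Sum>l\<in>A. l)"
      by (rule skew_lines_sum[OF A(1,2,4)])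
    then show "\<exists>A \<subseteq> (pic_lines :: 'n pic set). card A = r \<and>
              real_pic ` A = {v. v extreme_point_of F} \<and>
              (\<exists>D \<in> exceptional_systems. canonical + 3 *s D = (\<Sum>l\<in>A. l))"
      using A card by blast
  qed (use exceptional_transitive exceptional_bij_skew_lines card in simp_all)
qed

end
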